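(* Let $(\alpha_n,\beta_n)_{n\in\mathbb{Z}}$ be a bilateral Bailey pair relative to $a$. For all $N\geq0$, define \[ \alpha^{(N)}_n=(1-aq^{2n-N})(aq^{1-N})_N\sum_{j\in\mathbb{Z}}(-1)^j\frac{q^{N(n-j)+j(j-1)/2}}{(aq^{2n-N-j})_{N+1}}\begin{bmatrix}N\\ j\end{bmatrix}\alpha_{n-j},\qquad \beta^{(N)}_n=q^{nN}\beta_n . \] Then $(\alpha^{(N)}_n,\beta^{(N)}_n)$ is a bilateral Bailey pair relative to $aq^{-N}$.
   Context: Fix complex numbers $a,q$ with $|q|<1$ (parameters generic so that no denominator vanishes). For complex $x$, $(x)_\infty=\prod_{j\ge0}(1-xq^j)$ and for $k\in\mathbb{Z}$, $(x)_k=(x)_\infty/(xq^k)_\infty$ (so $1/(q)_k=0$ for $k<0$). A bilateral Bailey pair relative to $c$ is a pair of sequences $(\alpha_n)_{n\in\mathbb{Z}},(\beta_n)_{n\in\mathbb{Z}}$ such that for every $n\in\mathbb{Z}$, $\beta_n=\sum_{j\le n}\frac{\alpha_j}{(q)_{n-j}(cq)_{n+j}}$ (the series being convergent). For integers $N\ge0$ and $j$, $\begin{bmatrix}N\\ j\end{bmatrix}=\frac{(q)_N}{(q)_j(q)_{N-j}}$ if $0\le j\le N$ and $0$ otherwise.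
   Formalization: The formal theorem also assumes a ≠ 0 (besides q ≠ 0 and aq^m ≠ 1 for all integers m, i.e. no vanishing denominators): for a = 0 the claim fails, e.g. N = 1, α_n = q^{-n}, where α^{(1)} vanishes but β^{(1)} does not. *)

theory Defs
  imports "HOL-Analysis.Analysis"
begin

definition qpoch_inf :: "complex \<Rightarrow> complex \<Rightarrow> complex" where
  "qpoch_inf q x = (\<Prod>j. 1 - x * q ^ j)"

definition qpoch :: "complex \<Rightarrow> complex \<Rightarrow> int \<Rightarrow> complex" where
  "qpoch q x k = qpoch_inf q x / qpoch_inf q (x * q powi k)"

definition qbinom :: "complex \<Rightarrow> nat \<Rightarrow> int \<Rightarrow> complex" where
  "qbinom q N j =
     (if 0 \<le> j \<and> j \<le> int N
      then qpoch q q (int N) / (qpoch q q j * qpoch q q (int N - j))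
      else 0)"

(* The series over all integers j \<le> n is read as the ordinary (possibly only
   conditionally convergent) one-sided series with j = n, n - 1, n - 2, ... *)
definition bilateral_bailey_pair ::
  "complex \<Rightarrow> complex \<Rightarrow> (int \<Rightarrow> complex) \<Rightarrow> (int \<Rightarrow> complex) \<Rightarrow> bool" where
  "bilateral_bailey_pair q c \<alpha> \<beta> \<longleftrightarrow>
     (\<forall>n. (\<lambda>k::nat. let j = n - int k in
              \<alpha> j / (qpoch q q (n - j) * qpoch q (c * q) (n + j))) sums \<beta> n)"

(* The sum over all integers j has finite support {0..N}; j * (j - 1) is even, so div is exact. *)
definition alpha_N :: "complex \<Rightarrow> complex \<Rightarrow> nat \<Rightarrow> (int \<Rightarrow> complex) \<Rightarrow> int \<Rightarrow> complex" where
  "alpha_N a q N \<alpha> n =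
     (1 - a * q powi (2 * n - int N)) * qpoch q (a * q powi (1 - int N)) (int N) *
     (\<Sum>\<^sub>\<infinity>j\<in>(UNIV :: int set).
        (-1) powi j *
        (q powi (int N * (n - j) + j * (j - 1) div 2)
          / qpoch q (a * q powi (2 * n - int N - j)) (int N + 1)) *
        qbinom q N j * \<alpha> (n - j))"

definition beta_N :: "complex \<Rightarrow> nat \<Rightarrow> (int \<Rightarrow> complex) \<Rightarrow> int \<Rightarrow> complex" where
  "beta_N q N \<beta> n = q powi (n * int N) * \<beta> n"

end

theory Submission
  imports Defs
begin

text \<open>
  The theorem is the \<open>N\<close>-fold iterate of its case \<open>N = 1\<close>, applied relative to
  \<open>a\<close>, \<open>a / q\<close>, \<open>a / q\<^sup>2\<close>, and so on. With
  \<open>A\<^sub>n = q\<^sup>n \<alpha>\<^sub>n / (1 - c q\<^bsup>2n\<^esup>)\<close> that case replaces \<open>\<alpha>\<^sub>n\<close> by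
  \<open>(1 - c) (A\<^sub>n - A\<^bsub>n-1\<^esub>)\<close>, and summation by parts returns \<open>q\<^sup>n\<close> times the old
  partial sum minus a boundary term. The boundary term is the \<open>K\<close>-th term of the old series,
  which tends to \<open>0\<close>, times a factor of size \<open>O(q\<^sup>K)\<close>; hence conditional convergence of the
  old series suffices. That the iterates are given by the stated closed form is a contiguous
  relation combining the two \<open>q\<close>-Pascal rules.
\<close>

section \<open>q-Pochhammer symbols: recurrences and nonvanishing\<close>

lemma convergent_prod_qpoch:
  fixes q x :: complex
  assumes "norm q < 1"
  shows "convergent_prod (\<lambda>j. 1 - x * q ^ j)"
proof (rule abs_convergent_prod_imp_convergent_prod, rule summable_imp_abs_convergent_prod)
  show "summable (\<lambda>j. norm (1 - x * q ^ j - 1))"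
    using assms by (auto simp: norm_mult norm_power intro!: summable_mult summable_geometric)
qed

lemma qpoch_inf_nonzero:
  assumes "norm q < 1" "\<And>j::nat. x * q ^ j \<noteq> 1"
  shows "qpoch_inf q x \<noteq> 0"
  unfolding qpoch_inf_def using assms by (intro prodinf_nonzero convergent_prod_qpoch) auto

lemma qpoch_inf_rec:
  assumes "norm q < 1" "x \<noteq> 1"
  shows "qpoch_inf q x = (1 - x) * qpoch_inf q (x * q)"
  using prodinf_split_head[OF convergent_prod_qpoch[OF assms(1), of x]] assms(2)
  by (simp add: qpoch_inf_def mult_ac field_simps)

lemma qpoch_rec_left:
  assumes "norm q < 1" "q \<noteq> 0" "x \<noteq> 1"
  shows "qpoch q x (k + 1) = (1 - x) * qpoch q (x * q) k"
  using assms by (simp add: qpoch_def qpoch_inf_rec[of q x] power_int_add mult_ac)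

lemma qpoch_rec_right:
  assumes "norm q < 1" "q \<noteq> 0" "x * q powi k \<noteq> 1"
  shows "qpoch q x (k + 1) = (1 - x * q powi k) * qpoch q x k"
  using assms by (simp add: qpoch_def qpoch_inf_rec[of q "x * q powi k"] power_int_add mult_ac)

lemma power_Suc_neq_one:
  fixes q :: complex
  assumes "norm q < 1"
  shows "q * q ^ k \<noteq> 1"
proof
  assume "q * q ^ k = 1"
  hence "norm (q ^ Suc k) = 1" by simp
  thus False
    using assms power_Suc_less_one[of "norm q" k]
    by (cases "q = 0") (auto simp: norm_mult norm_power)
qed

lemma qpoch_q_0:
  assumes "norm q < 1"
  shows "qpoch q q 0 = 1"
  using qpoch_inf_nonzero[of q q] power_Suc_neq_one[of q] assms by (simp add: qpoch_def)

lemma qpoch_q_Suc: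
  assumes "norm q < 1" "q \<noteq> 0"
  shows "qpoch q q (int (Suc k)) = (1 - q ^ Suc k) * qpoch q q (int k)"
  using qpoch_rec_right[of q q "int k"] power_Suc_neq_one[of q k] assms
  by (simp add: add.commute)

lemma qpoch_q_nonzero:
  assumes "norm q < 1" "q \<noteq> 0"
  shows "qpoch q q (int k) \<noteq> 0"
proof (induction k)
  case 0
  thus ?case using assms by (simp add: qpoch_q_0)
next
  case (Suc k)
  thus ?case unfolding qpoch_q_Suc[OF assms] using power_Suc_neq_one[OF assms(1), of k] by simp
qed

text \<open>The quotient is nonzero because both infinite products are. As \<open>k\<close> may be
  negative, the factors of the lower product can start on either side of \<open>x\<close>, hence the
  hypothesis over all integers \<open>m\<close>.\<close>

lemma qpoch_nonzero:
  assumes "norm q < 1" "q \<noteq> 0" "\<And>m::int. x * q powi m \<noteq> 1"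
  shows "qpoch q x k \<noteq> 0"
proof -
  have "x * q ^ j \<noteq> 1" for j
    using assms(3)[of "int j"] by simp
  moreover have "x * q powi k * q ^ j \<noteq> 1" for j
    using assms(2) assms(3)[of "k + int j"] by (simp add: power_int_add mult_ac)
  ultimately show ?thesis
    using assms(1) by (simp add: qpoch_def qpoch_inf_nonzero)
qed

section \<open>The case N = 1\<close>

definition bailey_step :: "complex \<Rightarrow> complex \<Rightarrow> (int \<Rightarrow> complex) \<Rightarrow> int \<Rightarrow> complex" where
  "bailey_step q c \<alpha> n =
     (1 - c) * (q powi n * \<alpha> n / (1 - c * q powi (2 * n))
                - q powi (n - 1) * \<alpha> (n - 1) / (1 - c * q powi (2 * (n - 1))))"

lemma bilateral_bailey_pair_step:
  assumes q: "norm q < 1" "q \<noteq> 0" and c: "c \<noteq> 0" "\<And>m::int. c * q powi m \<noteq> 1"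
    and pair: "bilateral_bailey_pair q c \<alpha> \<beta>"
  shows "bilateral_bailey_pair q (c / q) (bailey_step q c \<alpha>) (\<lambda>n. q powi n * \<beta> n)"
proof -
  have main: "(\<lambda>k. bailey_step q c \<alpha> (n - int k) / (qpoch q q (int k) * qpoch q c (2 * n - int k)))
      sums (q powi n * \<beta> n)" for n
  proof -
    define t where "t k = \<alpha> (n - int k) / (qpoch q q (int k) * qpoch q (c * q) (2 * n - int k))" for k
    define u where
      "u k = bailey_step q c \<alpha> (n - int k) / (qpoch q q (int k) * qpoch q c (2 * n - int k))" for k
    \<comment> \<open>\<open>R\<close> is chosen so that \<open>R (Suc k) * t (Suc k)\<close> is the
      \<open>\<alpha> (m - 1)\<close> half of \<open>u k\<close>, where m = n - k: the factor 1 -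
      q^(k+1) turns 1/(q)_(k+1) into 1/(q)_k.\<close>
    define R where "R k = q powi (n - int k) * (1 - q ^ k) / (1 - c * q powi (2 * (n - int k)))" for k
    have "t sums \<beta> n"
      using pair[unfolded bilateral_bailey_pair_def, rule_format, of n]
      by (simp add: t_def[abs_def] Let_def algebra_simps)
    hence t_sums: "(\<lambda>K. sum t {..<K}) \<longlonglongrightarrow> \<beta> n" and t_lim: "t \<longlonglongrightarrow> 0"
      using summable_LIMSEQ_zero[OF sums_summable] by (auto simp: sums_def)
    have tele: "u k = q powi n * t k + R k * t k - R (Suc k) * t (Suc k)" for k
    proof -
      define m where "m = n - int k"
      define X where "X = q powi m"
      define Y where "Y = q ^ k"
      define Q where "Q = qpoch q q (int k)"
      \<comment> \<open>\<open>P\<close> is common to the three symbols in \<open>P1\<close>,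
        \<open>P2\<close> and \<open>P3\<close>. The factor 1 - c in \<open>P1\<close> cancels the
        prefactor of \<open>bailey_step\<close>.\<close>
      define P where "P = qpoch q (c * q) (2 * n - int k - 1)"
      have XY: "q powi n = X * Y"
        using q by (simp add: X_def Y_def m_def power_int_diff)
      have cq: "c * q * q powi l \<noteq> 1" for l
        using c(2)[of "l + 1"] q by (simp add: power_int_add mult_ac)
      have nz: "Q \<noteq> 0" "P \<noteq> 0" "1 - c \<noteq> 0" "1 - q * Y \<noteq> 0"
        using qpoch_q_nonzero[OF q] qpoch_nonzero[OF q cq] c(2)[of 0] power_Suc_neq_one[OF q(1), of k]
        by (auto simp: Q_def P_def Y_def)
      have sq: "q powi (2 * m) = X ^ 2"
        by (simp add: X_def power_int_mult mult.commute)
      have sq': "q powi (2 * (m - 1)) = (X / q) ^ 2" "q powi (m - 1) = X / q"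
        using q by (simp_all add: X_def power_int_mult power_int_diff power_divide mult.commute)
      have e: "q powi (2 * n - int k) = X * X * Y"
        using q XY by (simp add: power_int_diff power_int_mult mult.commute[of 2] power2_eq_square Y_def)
      have nz2: "1 - c * X ^ 2 \<noteq> 0" "1 - c * (X / q) ^ 2 \<noteq> 0" "1 - c * (X * X * Y) \<noteq> 0"
        using c(2)[of "2 * m"] c(2)[of "2 * (m - 1)"] c(2)[of "2 * n - int k"]
        unfolding sq sq' e by auto
      have Q': "qpoch q q (int (Suc k)) = (1 - q * Y) * Q"
        unfolding qpoch_q_Suc[OF q] by (simp add: Y_def Q_def)
      have P1: "qpoch q c (2 * n - int k) = (1 - c) * P"
        using qpoch_rec_left[OF q, of c "2 * n - int k - 1"] c(2)[of 0] by (simp add: P_def)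
      have "c * q * q powi (2 * n - int k - 1) = c * (X * X * Y)"
        using e q by (simp add: power_int_diff)
      hence P2: "qpoch q (c * q) (2 * n - int k) = (1 - c * (X * X * Y)) * P"
        using qpoch_rec_right[OF q cq, of "2 * n - int k - 1"] by (simp add: P_def)
      have P3: "qpoch q (c * q) (2 * n - int (Suc k)) = P"
        by (simp add: P_def algebra_simps)
      have m': "n - int (Suc k) = m - 1"
        by (simp add: m_def)
      have "u k = (X * \<alpha> m / (1 - c * X ^ 2) - X / q * \<alpha> (m - 1) / (1 - c * (X / q) ^ 2)) / (Q * P)"
        unfolding u_def bailey_step_def P1 m_def[symmetric] sq sq' X_def[symmetric] Q_def[symmetric]
        using nz by simp
      moreover have "R (Suc k) * t (Suc k) = X / q * \<alpha> (m - 1) / (1 - c * (X / q) ^ 2) / (Q * P)"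
        unfolding R_def t_def m' sq' Q' P3 using nz by (simp add: Y_def)
      moreover have "q powi n * t k + R k * t k = X * \<alpha> m / (1 - c * X ^ 2) / (Q * P)"
      proof -
        \<comment> \<open>The numerator over X is Y (1 - c X^2) + 1 - Y = 1 - c X^2 Y, exactly the
          factor that \<open>P2\<close> puts into the denominator of \<open>t k\<close>.\<close>
        have "X * Y + X * (1 - Y) / (1 - c * X ^ 2) = X * (1 - c * (X * X * Y)) / (1 - c * X ^ 2)"
          using nz2(1) by (simp add: divide_simps) (simp add: algebra_simps power2_eq_square)
        hence "q powi n + R k = X * (1 - c * (X * X * Y)) / (1 - c * X ^ 2)"
          unfolding R_def m_def[symmetric] sq XY X_def[symmetric] Y_def[symmetric] .
        moreover have "t k = \<alpha> m / (Q * ((1 - c * (X * X * Y)) * P))"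
          unfolding t_def P2 m_def Q_def ..
        ultimately have "(q powi n + R k) * t k = X * \<alpha> m / (1 - c * X ^ 2) / (Q * P)"
          using nz2(3) by simp
        thus ?thesis
          by (simp only: distrib_right)
      qed
      ultimately show ?thesis
        by (simp add: diff_divide_distrib)
    qed
    \<comment> \<open>The lower boundary term is absent because \<open>R 0 = 0\<close>.\<close>
    have partial: "sum u {..<K} = q powi n * sum t {..<K} - R K * t K" for K
    proof (induction K)
      case 0
      show ?case by (simp add: R_def)
    next
      case (Suc K)
      thus ?case by (simp add: tele algebra_simps)
    qed
    \<comment> \<open>Multiplying numerator and denominator by q^(2K) leaves only nonnegative powers
      of q^K: the numerator tends to 0, the denominator to the nonzero number -c q^(2n).\<close>
    have "R K = q powi n * (q ^ K * (1 - q ^ K)) / ((q ^ K) ^ 2 - c * q powi (2 * n))" for K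
    proof -
      have "q powi (2 * (n - int K)) = q powi (2 * n) / (q ^ K) ^ 2"
        using q by (simp add: right_diff_distrib power_int_diff power_int_mult mult.commute[of 2])
      thus ?thesis
        using q by (simp add: R_def power_int_diff divide_simps power2_eq_square)
    qed
    moreover have "(\<lambda>K. q powi n * (q ^ K * (1 - q ^ K)) / ((q ^ K) ^ 2 - c * q powi (2 * n)))
        \<longlonglongrightarrow> q powi n * (0 * (1 - 0)) / (0 ^ 2 - c * q powi (2 * n))"
      using q c by (intro tendsto_intros LIMSEQ_power_zero) auto
    ultimately have "R \<longlonglongrightarrow> 0"
      by (simp add: R_def[abs_def])
    from tendsto_diff[OF tendsto_mult_left[OF t_sums, of "q powi n"] tendsto_mult[OF this t_lim]]
    have "u sums (q powi n * \<beta> n)"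
      by (simp add: sums_def partial)
    thus ?thesis
      by (simp add: u_def[abs_def])
  qed
  show ?thesis
    unfolding bilateral_bailey_pair_def Let_def
  proof
    fix n
    have "n - (n - int k) = int k" "n + (n - int k) = 2 * n - int k" for k
      by simp_all
    thus "(\<lambda>k. bailey_step q c \<alpha> (n - int k) /
        (qpoch q q (n - (n - int k)) * qpoch q (c / q * q) (n + (n - int k)))) sums (q powi n * \<beta> n)"
      using main[of n] q(2) by (simp only: nonzero_divide_eq_eq[symmetric] times_divide_eq_left) simp
  qed
qed

section \<open>The recurrence in N satisfied by the closed form\<close>

definition alpha_N_term :: "complex \<Rightarrow> complex \<Rightarrow> nat \<Rightarrow> (int \<Rightarrow> complex) \<Rightarrow> int \<Rightarrow> int \<Rightarrow> complex" where
  "alpha_N_term a q N \<alpha> n j =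
     (-1) powi j * (q powi (int N * (n - j) + j * (j - 1) div 2)
       / qpoch q (a * q powi (2 * n - int N - j)) (int N + 1)) * qbinom q N j * \<alpha> (n - j)"

text \<open>The q-binomial vanishes outside {0..N}. The set \<open>A\<close> is left free because
  the recurrence in N compares sums over shifted index ranges.\<close>

lemma alpha_N_eq_sum:
  assumes "finite A" "{0..int N} \<subseteq> A"
  shows "alpha_N a q N \<alpha> n = (1 - a * q powi (2 * n - int N)) *
    qpoch q (a * q powi (1 - int N)) (int N) * sum (alpha_N_term a q N \<alpha> n) A"
proof -
  have "infsum (alpha_N_term a q N \<alpha> n) UNIV = infsum (alpha_N_term a q N \<alpha> n) A"
    using assms(2) by (intro infsum_cong_neutral) (auto simp: alpha_N_term_def qbinom_def)
  thus ?thesis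
    using assms(1) by (simp add: alpha_N_def alpha_N_term_def[abs_def])
qed

lemma qbinom_Suc_lower:
  assumes "norm q < 1" "q \<noteq> 0"
  shows "(1 - q ^ Suc N) * qbinom q N j = (1 - q powi (int N + 1 - j)) * qbinom q (Suc N) j"
proof (cases "0 \<le> j \<and> j \<le> int N")
  case True
  define i where "i = nat (int N - j)"
  have i: "int N - j = int i" "int (Suc N) - j = int (Suc i)" "int N + 1 - j = int (Suc i)"
    using True by (auto simp: i_def)
  have "1 - q ^ Suc i \<noteq> 0"
    using power_Suc_neq_one[OF assms(1), of i] by simp
  thus ?thesis
    using True unfolding qbinom_def i qpoch_q_Suc[OF assms] power_int_of_nat by simp
next
  case False
  thus ?thesis
    \<comment> \<open>At j = N + 1 the binomial on the right is nonzero, but its factor is 1 - q^0 =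
      0.\<close>
    by (cases "j = int N + 1") (auto simp: qbinom_def)
qed

lemma qbinom_Suc_both:
  assumes "norm q < 1" "q \<noteq> 0"
  shows "(1 - q ^ Suc N) * qbinom q N (j - 1) = (1 - q powi j) * qbinom q (Suc N) j"
proof (cases "1 \<le> j \<and> j \<le> int N + 1")
  case True
  define i where "i = nat (j - 1)"
  have i: "j = int (Suc i)" "int (Suc i) - 1 = int i"
    using True by (auto simp: i_def)
  have "1 - q ^ Suc i \<noteq> 0"
    using power_Suc_neq_one[OF assms(1), of i] by simp
  thus ?thesis
    using True unfolding qbinom_def i qpoch_q_Suc[OF assms] power_int_of_nat by simp
next
  case False
  thus ?thesis
    by (cases "j = 0") (auto simp: qbinom_def)
qed

text \<open>Both sides are affine in \<open>x\<close>, and comparing the two coefficients gives the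
  two q-Pascal rules. The proof checks them together by writing both lower binomials as multiples of
  the upper one.\<close>

lemma qbinom_contiguous:
  assumes "norm q < 1" "q \<noteq> 0"
  shows "(1 - x * q powi j) * qbinom q (Suc N) j =
    q powi j * (1 - x) * qbinom q N j + (1 - x * q ^ Suc N) * qbinom q N (j - 1)"
proof -
  define s where "s = q ^ Suc N"
  define J where "J = q powi j"
  define B where "B = qbinom q (Suc N) j"
  have s: "1 - s \<noteq> 0"
    using power_Suc_neq_one[OF assms(1), of N] by (simp add: s_def)
  have J: "J \<noteq> 0"
    using assms by (simp add: J_def)
  have "q powi (int N + 1 - j) = s / J"
    using assms by (simp add: s_def J_def power_int_diff power_int_add mult.commute)
  hence "(1 - s) * qbinom q N j = (1 - s / J) * B" "(1 - s) * qbinom q N (j - 1) = (1 - J) * B"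
    using qbinom_Suc_lower[OF assms, of N j] qbinom_Suc_both[OF assms, of N j]
    by (simp_all add: s_def J_def B_def)
  hence e: "qbinom q N j = (1 - s / J) * B / (1 - s)" "qbinom q N (j - 1) = (1 - J) * B / (1 - s)"
    using s by (simp_all add: eq_divide_eq mult.commute)
  show ?thesis
    unfolding e s_def[symmetric] J_def[symmetric] B_def[symmetric]
    using s J by (simp add: divide_simps) (simp add: algebra_simps)
qed

text \<open>All three summands contain the same \<open>\<alpha> (n - j)\<close>. With x = a
  q^(2n-N-1-j) their symbols are (x)_(N+2), (xq)_(N+1) and (x)_(N+1), which differ by the factors 1
  - x and 1 - x q^(N+1); what remains is \<open>qbinom_contiguous\<close> at this x.\<close>

lemma alpha_N_term_Suc:
  assumes q: "norm q < 1" "q \<noteq> 0" and a: "\<And>m::int. a * q powi m \<noteq> 1"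
  shows "(1 - a * q powi (2 * n - int (Suc N))) * alpha_N_term a q (Suc N) \<alpha> n j =
    q powi n * alpha_N_term a q N \<alpha> n j - q powi (n - 1) * alpha_N_term a q N \<alpha> (n - 1) (j - 1)"
proof -
  define x where "x = a * q powi (2 * n - int (Suc N) - j)"
  define D where "D = qpoch q x (int N + 1 + 1)"
  define E where "E = q powi (int N * (n - j) + j * (j - 1) div 2)"
  have x: "x * q powi l \<noteq> 1" for l
    using a[of "2 * n - int (Suc N) - j + l"] q by (simp add: x_def power_int_add mult_ac)
  have D: "D \<noteq> 0"
    unfolding D_def using q x by (rule qpoch_nonzero)
  have x1: "1 - x \<noteq> 0" and x2: "1 - x * q ^ Suc N \<noteq> 0"
    using x[of 0] x[of "int (Suc N)"] unfolding power_int_of_nat by auto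
  have "a * q powi (2 * n - int N - j) = a * q powi ((2 * n - int (Suc N) - j) + 1)"
    by (rule arg_cong[where f = "\<lambda>m. a * q powi m"]) simp
  also have "\<dots> = x * q"
    using q by (simp only: x_def power_int_add_1 mult.assoc simp_thms)
  finally have xq: "a * q powi (2 * n - int N - j) = x * q" .
  have D1: "qpoch q (x * q) (int N + 1) = D / (1 - x)"
    using qpoch_rec_left[OF q, of x "int N + 1"] x1 by (simp add: D_def)
  have "q powi (int N + 1) = q ^ Suc N"
    using power_int_of_nat[of q "Suc N"] by (simp add: add.commute)
  hence D2: "qpoch q x (int N + 1) = D / (1 - x * q ^ Suc N)"
    using qpoch_rec_right[OF q x, of "int N + 1"] x2 by (simp add: D_def)
  have xj: "a * q powi (2 * n - int (Suc N)) = x * q powi j"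
    using q by (simp add: x_def power_int_diff)
  \<comment> \<open>The two numerators differ by 2 (j - 1), a multiple of 2 that passes through
    \<open>div 2\<close>.\<close>
  have even: "j * (j - 1) div 2 = (j - 1) * (j - 1 - 1) div 2 + (j - 1)"
  proof -
    have "j * (j - 1) = (j - 1) * (j - 1 - 1) + (j - 1) * 2"
      by (simp add: algebra_simps)
    thus ?thesis by simp
  qed
  have E1: "q powi (int (Suc N) * (n - j) + j * (j - 1) div 2) = E * (q powi n / q powi j)"
  proof -
    have "int (Suc N) * (n - j) + j * (j - 1) div 2 = (int N * (n - j) + j * (j - 1) div 2) + (n - j)"
      by (simp add: algebra_simps)
    thus ?thesis using q by (simp only: E_def power_int_add power_int_diff simp_thms)
  qed
  \<comment> \<open>The outer power q^(n-1) makes up for the drop by j - 1 in the triangular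
    exponent, so that the result agrees with \<open>E1\<close>.\<close>
  have E2: "q powi (n - 1) * q powi (int N * (n - 1 - (j - 1)) + (j - 1) * (j - 1 - 1) div 2)
      = E * (q powi n / q powi j)"
  proof -
    have "(n - 1) + (int N * (n - 1 - (j - 1)) + (j - 1) * (j - 1 - 1) div 2)
        = (int N * (n - j) + j * (j - 1) div 2) + (n - j)"
      unfolding even by simp
    thus ?thesis using q by (simp only: E_def power_int_add[symmetric] power_int_diff[symmetric] simp_thms)
  qed
  have sgn: "(-1 :: complex) powi (j - 1) = - ((-1) powi j)"
    by (simp add: power_int_diff)
  have t1: "alpha_N_term a q (Suc N) \<alpha> n j =
      (-1) powi j * (E * (q powi n / q powi j) / D) * qbinom q (Suc N) j * \<alpha> (n - j)"
    unfolding alpha_N_term_def E1 x_def[symmetric] D_def by (simp add: add_ac)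
  have t2: "alpha_N_term a q N \<alpha> n j =
      (-1) powi j * (E / (D / (1 - x))) * qbinom q N j * \<alpha> (n - j)"
    unfolding alpha_N_term_def E_def xq D1 ..
  have arg: "2 * (n - 1) - int N - (j - 1) = 2 * n - int (Suc N) - j"
    by simp
  have t3: "q powi (n - 1) * alpha_N_term a q N \<alpha> (n - 1) (j - 1) =
      - ((-1) powi j) * (E * (q powi n / q powi j) / (D / (1 - x * q ^ Suc N)))
        * qbinom q N (j - 1) * \<alpha> (n - j)"
    unfolding alpha_N_term_def arg x_def[symmetric] D2 E2[symmetric] sgn by simp
  have "(1 - x * q powi j) * alpha_N_term a q (Suc N) \<alpha> n j =
      (-1) powi j * (E * (q powi n / q powi j) / D) * \<alpha> (n - j) *
      ((1 - x * q powi j) * qbinom q (Suc N) j)"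
    unfolding t1 by (simp add: mult_ac)
  also have "\<dots> = q powi n * alpha_N_term a q N \<alpha> n j
      - q powi (n - 1) * alpha_N_term a q N \<alpha> (n - 1) (j - 1)"
    unfolding qbinom_contiguous[OF q] t2 t3 using q D x1 x2
    by (simp add: divide_simps) (simp add: algebra_simps)
  finally show ?thesis
    unfolding xj .
qed

lemma alpha_N_Suc:
  assumes q: "norm q < 1" "q \<noteq> 0" and a: "\<And>m::int. a * q powi m \<noteq> 1"
  shows "alpha_N a q (Suc N) \<alpha> = bailey_step q (a * q powi (- int N)) (alpha_N a q N \<alpha>)"
proof
  fix n
  define c where "c = a * q powi (- int N)"
  define T where "T = qpoch q (a * q powi (1 - int N)) (int N)"
  have c: "c \<noteq> 1"
    using a unfolding c_def .
  have cm: "c * q powi m = a * q powi (m - int N)" for m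
    using q by (simp add: c_def power_int_minus power_int_diff divide_inverse)
  \<comment> \<open>This supplies the factor 1 - c of \<open>bailey_step\<close>.\<close>
  have T': "qpoch q (a * q powi (1 - int (Suc N))) (int (Suc N)) = (1 - c) * T"
  proof -
    have "a * q powi (1 - int (Suc N)) = c" "a * q powi (1 - int N) = c * q"
      using q by (simp_all add: c_def power_int_minus power_int_diff divide_inverse)
    thus ?thesis
      using qpoch_rec_left[OF q c, of "int N"] by (simp add: T_def add.commute)
  qed
  \<comment> \<open>Since c q^(2m) = a q^(2m-N), the denominator in \<open>bailey_step\<close>
    cancels the first prefactor of \<open>alpha_N\<close>.\<close>
  have div: "alpha_N a q N \<alpha> m / (1 - c * q powi (2 * m)) = T * sum (alpha_N_term a q N \<alpha> m) A"
    if "finite A" "{0..int N} \<subseteq> A" for m A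
    unfolding alpha_N_eq_sum[OF that] cm T_def using a[of "2 * m - int N"] by simp
  have "alpha_N a q (Suc N) \<alpha> n = (1 - c) * T *
      (\<Sum>j\<in>{0..int (Suc N)}. (1 - a * q powi (2 * n - int (Suc N))) * alpha_N_term a q (Suc N) \<alpha> n j)"
    using alpha_N_eq_sum[of "{0..int (Suc N)}" "Suc N" a q \<alpha> n]
    by (simp only: T' sum_distrib_left[symmetric]) simp
  also have "\<dots> = (1 - c) * T * (q powi n * sum (alpha_N_term a q N \<alpha> n) {0..int (Suc N)}
      - q powi (n - 1) * (\<Sum>j\<in>{0..int (Suc N)}. alpha_N_term a q N \<alpha> (n - 1) (j - 1)))"
    by (simp only: alpha_N_term_Suc[OF q a] sum_subtractf sum_distrib_left)
  \<comment> \<open>The shifted range {-1..N} still contains the support {0..N}, so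
    \<open>div\<close> applies to it as well as to {0..N+1}.\<close>
  also have "(\<Sum>j\<in>{0..int (Suc N)}. alpha_N_term a q N \<alpha> (n - 1) (j - 1)) =
      sum (alpha_N_term a q N \<alpha> (n - 1)) {-1..int N}"
    by (rule sum.reindex_bij_witness[where i = "\<lambda>j. j + 1" and j = "\<lambda>j. j - 1"]) auto
  also have "(1 - c) * T * (q powi n * sum (alpha_N_term a q N \<alpha> n) {0..int (Suc N)}
      - q powi (n - 1) * sum (alpha_N_term a q N \<alpha> (n - 1)) {-1..int N}) =
      (1 - c) * (q powi n * (alpha_N a q N \<alpha> n / (1 - c * q powi (2 * n)))
      - q powi (n - 1) * (alpha_N a q N \<alpha> (n - 1) / (1 - c * q powi (2 * (n - 1)))))"
    by (subst (1) div[of "{0..int (Suc N)}"], simp, simp, subst div[of "{-1..int N}"])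
       (auto simp: algebra_simps)
  finally show "alpha_N a q (Suc N) \<alpha> n = bailey_step q (a * q powi (- int N)) (alpha_N a q N \<alpha>) n"
    by (simp add: bailey_step_def c_def)
qed

text \<open>Only j = 0 contributes, and its denominator (y)_1 = 1 - y with y = a q^(2n) cancels the
  prefactor.\<close>

lemma alpha_N_0:
  assumes q: "norm q < 1" "q \<noteq> 0" and a: "\<And>m::int. a * q powi m \<noteq> 1"
  shows "alpha_N a q 0 \<alpha> = \<alpha>"
proof
  fix n
  have shift: "a * q powi k * q powi m \<noteq> 1" for k m
    using a[of "k + m"] q by (simp add: power_int_add mult_ac)
  have qpoch_0: "qpoch q (a * q powi k) 0 = 1" for k
    using qpoch_inf_nonzero[OF q(1), of "a * q powi k"] shift[of k "int j" for j]
    by (simp add: qpoch_def)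
  have "qpoch q (a * q powi (2 * n)) 1 = 1 - a * q powi (2 * n)"
    using qpoch_rec_right[OF q shift, of "2 * n" 0] by (simp add: qpoch_0)
  thus "alpha_N a q 0 \<alpha> n = \<alpha> n"
    using alpha_N_eq_sum[of "{0}" 0 a q \<alpha> n] a[of "2 * n"] qpoch_0[of 1]
    by (simp add: alpha_N_term_def qbinom_def qpoch_q_0[OF q(1)])
qed

theorem theorem3p4:
  fixes a q :: complex and \<alpha> \<beta> :: "int \<Rightarrow> complex" and N :: nat
  assumes "norm q < 1" and "q \<noteq> 0" and "a \<noteq> 0"
    and "\<And>m::int. a * q powi m \<noteq> 1"
    and "bilateral_bailey_pair q a \<alpha> \<beta>"
  shows "bilateral_bailey_pair q (a * q powi (- int N)) (alpha_N a q N \<alpha>) (beta_N q N \<beta>)"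
proof (induction N)
  case 0
  have "beta_N q 0 \<beta> = \<beta>"
    by (simp add: beta_N_def fun_eq_iff)
  thus ?case
    using assms by (simp add: alpha_N_0)
next
  case (Suc N)
  \<comment> \<open>The pair for N is relative to this \<open>c\<close>. Genericity passes from
    \<open>a\<close> to \<open>c\<close> because it is assumed for all integer exponents.\<close>
  define c where "c = a * q powi (- int N)"
  have "c * q powi m \<noteq> 1" for m
    using assms(4)[of "m - int N"] assms(2)
    by (simp add: c_def power_int_minus power_int_diff divide_inverse mult_ac)
  moreover have "c \<noteq> 0"
    using assms by (simp add: c_def)
  ultimately have "bilateral_bailey_pair q (c / q) (bailey_step q c (alpha_N a q N \<alpha>))
      (\<lambda>n. q powi n * beta_N q N \<beta> n)"
    using assms(1,2) Suc by (intro bilateral_bailey_pair_step) (simp_all add: c_def)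
  moreover have "c / q = a * q powi (- int (Suc N))"
    using assms(2) by (simp add: c_def power_int_minus power_int_diff divide_inverse mult_ac)
  moreover have "(\<lambda>n. q powi n * beta_N q N \<beta> n) = beta_N q (Suc N) \<beta>"
    using assms(2) by (simp add: beta_N_def fun_eq_iff power_int_add algebra_simps)
  ultimately show ?case
    using assms by (simp add: alpha_N_Suc c_def)
qed

end
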